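(* Let $N$ be a Poisson process on $[0,\infty)$ with intensity $\lambda>0$, with points $0<X_1<X_2<\cdots$, and let $\epsilon>0$, $L>0$. Define $G(-1)=e^{-\lambda L}$ and, for integers $k\ge0$, $$G(k)=(-1)^k\left(e^{-k\lambda\epsilon}\sum_{j=0}^k\frac{[\lambda(k\epsilon-L)]^j}{j!}-e^{-\lambda L}\right)\mathbf{1}_{\{L>k\epsilon\}}.$$ Then for every integer $n\ge0$, $$\Pr(\beta_0'(L)=n)=\sum_{i=n}^{\lfloor L/\epsilon\rfloor+1}(-1)^{i+n}\binom{i}{n}\big(G(i-1)+G(i)\big).$$
   Context: A cluster is a maximal set of consecutive points $X_j,\dots,X_k$ with $X_{l+1}-X_l\le\epsilon$ for $j\le l<k$. $\beta_0'(L)$ denotes the number of incomplete clusters in $[0,L]$, i.e. the number of clusters having at least one point in $[0,L]$ (equivalently, whose first point is $\le L$). *)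

theory Defs
  imports "HOL-Probability.Probability"
begin

text \<open>Poisson process on [0,inf) with intensity lambda, given through its points
  X_1 < X_2 < ...: X_k is the sum of the first k of i.i.d. Exp(lambda)
  interarrival times T 0, T 1, ...  Points are indexed from 1.\<close>

definition pp_point :: "(nat \<Rightarrow> 'a \<Rightarrow> real) \<Rightarrow> nat \<Rightarrow> 'a \<Rightarrow> real" where
  "pp_point T k \<omega> = (\<Sum>i<k. T i \<omega>)"

definition poisson_process_interarrivals ::
    "'a measure \<Rightarrow> real \<Rightarrow> (nat \<Rightarrow> 'a \<Rightarrow> real) \<Rightarrow> bool" where
  "poisson_process_interarrivals M lam T \<longleftrightarrow>
     prob_space M \<and> prob_space.indep_vars M (\<lambda>_. borel) T UNIV \<and>
     (\<forall>i. distributed M lborel (T i) (exponential_density lam))"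

definition same_cluster :: "(nat \<Rightarrow> real) \<Rightarrow> real \<Rightarrow> nat \<Rightarrow> nat \<Rightarrow> bool" where
  "same_cluster X eps i k \<longleftrightarrow> 1 \<le> i \<and> 1 \<le> k \<and>
     (\<forall>l. min i k \<le> l \<and> l < max i k \<longrightarrow> X (Suc l) - X l \<le> eps)"

definition clusters :: "(nat \<Rightarrow> real) \<Rightarrow> real \<Rightarrow> nat set set" where
  "clusters X eps = {S. \<exists>i\<ge>1. S = {k. same_cluster X eps i k}}"

definition beta0' :: "(nat \<Rightarrow> real) \<Rightarrow> real \<Rightarrow> real \<Rightarrow> nat" where
  "beta0' X eps L = card {S \<in> clusters X eps. \<exists>l\<in>S. 0 \<le> X l \<and> X l \<le> L}"

definition G :: "real \<Rightarrow> real \<Rightarrow> real \<Rightarrow> int \<Rightarrow> real" where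
  "G lam eps L k =
     (if k = -1 then exp (- lam * L)
      else if k \<ge> 0 \<and> L > real_of_int k * eps then
        (-1) ^ nat k * (exp (- real_of_int k * lam * eps) *
          (\<Sum>j\<le>nat k. (lam * (real_of_int k * eps - L)) ^ j / fact j) - exp (- lam * L))
      else 0)"

end

theory Submission
  imports Defs
begin

text \<open>
  Let \<open>N\<close> be the number of points up to \<open>L\<close>, and \<open>D\<close> the number of gaps longer than \<open>eps\<close> between
  consecutive ones, so that \<open>\<beta>\<^sub>0' = 1 + D\<close> if \<open>N \<ge> 1\<close> and \<open>\<beta>\<^sub>0' = 0\<close> otherwise. By memorylessness,
  forcing \<open>k\<close> prescribed gaps to exceed \<open>eps\<close> costs a factor \<open>exp (- k lam eps)\<close> and shortens
  the window to \<open>L - k eps\<close>. Summing over the \<open>(N - 1) choose k\<close> choices of the gaps gives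
  \<open>E (D choose k; N \<ge> 1) = G k\<close>, and Pascal's rule turns this into the binomial moments
  \<open>G (i - 1) + G i\<close> of \<open>\<beta>\<^sub>0'\<close>. As \<open>\<beta>\<^sub>0' \<le> \<lfloor>L / eps\<rfloor> + 1\<close>, its law follows by binomial inversion.
\<close>

section \<open>Exponential series with binomial weights, and binomial inversion\<close>

text \<open>Since \<open>(n choose j) / n! = 1 / (j! (n - j)!)\<close>, this is the exponential
  series shifted by \<open>j\<close>. Up to the factor \<open>exp (- u)\<close> it is the
  \<open>j\<close>-th binomial moment of a Poisson variable.\<close>

lemma choose_exp_sums:
  fixes u :: real
  shows "(\<lambda>n. real (n choose j) * (u ^ n / fact n)) sums (u ^ j / fact j * exp u)"
proof -
  have "(\<lambda>n. u ^ j / fact j * (u ^ n / fact n)) sums (u ^ j / fact j * exp u)"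
    using exp_converges[of u] by (intro sums_mult) (simp add: divide_inverse mult.commute)
  moreover have "real ((n + j) choose j) * (u ^ (n + j) / fact (n + j)) = u ^ j / fact j * (u ^ n / fact n)" for n
    using binomial_fact[of j "n + j", where ?'a = real] by (simp add: power_add)
  ultimately have "(\<lambda>n. real ((n + j) choose j) * (u ^ (n + j) / fact (n + j))) sums (u ^ j / fact j * exp u)"
    by simp
  then show ?thesis
    by (subst (asm) sums_zero_iff_shift) auto
qed

text \<open>With \<open>n = Suc m\<close> points there are \<open>m\<close> gaps, so the Poisson
  weight and the binomial have indices one apart. The alternating partial row sum of
  \<open>n choose j\<close> over \<open>j \<le> k\<close> is
  \<open>(-1) ^ k * ((n - 1) choose k)\<close> for \<open>n \<ge> 1\<close>, which reduces the
  series to the previous one.\<close>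

lemma choose_exp_Suc_sums:
  fixes u :: real
  shows "(\<lambda>m. real (m choose k) * (u ^ Suc m / fact (Suc m))) sums
    ((-1) ^ k * ((\<Sum>j\<le>k. (- u) ^ j / fact j) * exp u - 1))"
proof -
  define h where "h n = (-1) ^ k * (\<Sum>j\<le>k. (-1) ^ j * (real (n choose j) * (u ^ n / fact n)))" for n
  have "h sums ((-1) ^ k * (\<Sum>j\<le>k. (-1) ^ j * (u ^ j / fact j * exp u)))"
    unfolding h_def by (intro sums_mult sums_sum choose_exp_sums)
  also have "(\<Sum>j\<le>k. (-1) ^ j * (u ^ j / fact j * exp u)) = (\<Sum>j\<le>k. (- u) ^ j / fact j) * exp u"
    unfolding sum_distrib_right by (intro sum.cong) (auto simp: power_minus[of u])
  finally have "h sums ((-1) ^ k * ((\<Sum>j\<le>k. (- u) ^ j / fact j) * exp u))" .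
  \<comment> \<open>The term at \<open>n = 0\<close> belongs to no \<open>Suc m\<close>. Dropping it
    produces the \<open>- 1\<close> in the result, and later the \<open>- exp (- lam * L)\<close> in
    \<open>G\<close>.\<close>
  moreover have "h 0 = (-1) ^ k"
  proof -
    have "(\<Sum>j\<le>k. (-1) ^ j * (real (0 choose j) * (u ^ 0 / fact 0))) = (\<Sum>j\<in>{0::nat}. (1::real))"
      by (rule sum.mono_neutral_cong_right) auto
    then show ?thesis by (simp add: h_def)
  qed
  ultimately have "(\<lambda>m. h (Suc m)) sums ((-1) ^ k * ((\<Sum>j\<le>k. (- u) ^ j / fact j) * exp u) - (-1) ^ k)"
    by (subst sums_Suc_iff) simp
  moreover have "h (Suc m) = real (m choose k) * (u ^ Suc m / fact (Suc m))" for m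
  proof -
    have "(\<Sum>j\<le>k. (-1) ^ j * real (Suc m choose j)) = (-1) ^ k * real (m choose k)"
      using gbinomial_sum_lower_neg[of "real (Suc m)" k]
      by (simp add: binomial_gbinomial mult.commute)
    then have "(-1) ^ k * (\<Sum>j\<le>k. (-1) ^ j * real (Suc m choose j)) = real (m choose k)"
      by (simp add: mult.assoc[symmetric] power_mult_distrib[symmetric])
    then have "real (m choose k) * (u ^ Suc m / fact (Suc m)) =
        (-1) ^ k * (\<Sum>j\<le>k. (-1) ^ j * real (Suc m choose j)) * (u ^ Suc m / fact (Suc m))"
      by simp
    also have "\<dots> = h (Suc m)"
      unfolding h_def mult.assoc sum_distrib_right ..
    finally show ?thesis ..
  qed
  ultimately show ?thesis
    by (simp add: right_diff_distrib)
qed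

text \<open>The product of the two binomials is
  \<open>(b choose n) * ((b - n) choose (i - n))\<close>, and what remains is the alternating sum of
  row \<open>b - n\<close>, which vanishes unless \<open>b = n\<close>. Terms with
  \<open>i > b\<close> are zero, so any upper bound \<open>K\<close> of \<open>b\<close> may serve
  as the limit.\<close>

lemma binomial_moment_inversion:
  fixes b n K :: nat
  assumes "b \<le> K"
  shows "(\<Sum>i = n..K. (-1) ^ (i + n) * real (i choose n) * real (b choose i)) = of_bool (b = n)"
proof (cases "n \<le> b")
  case False
  then show ?thesis by (auto intro!: sum.neutral simp: binomial_eq_0)
next
  case True
  have "(\<Sum>i = n..K. (-1) ^ (i + n) * real (i choose n) * real (b choose i)) =
      (\<Sum>i = n..b. (-1) ^ (i + n) * real (i choose n) * real (b choose i))"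
    using assms by (intro sum.mono_neutral_right) (auto simp: binomial_eq_0)
  also have "\<dots> = (\<Sum>i = n..b. real (b choose n) * ((-1) ^ (i - n) * real ((b - n) choose (i - n))))"
  proof (intro sum.cong refl)
    fix i assume i: "i \<in> {n..b}"
    have "(b choose i) * (i choose n) = (b choose n) * ((b - n) choose (i - n))"
      using i by (intro choose_mult) auto
    then have "real (i choose n) * real (b choose i) = real (b choose n) * real ((b - n) choose (i - n))"
      by (metis of_nat_mult mult.commute)
    moreover have "(-1::real) ^ (i + n) = (-1) ^ (i - n)"
      using i by (intro minus_one_power_iff[THEN trans] minus_one_power_iff[THEN trans, symmetric]) auto
    ultimately show "(-1) ^ (i + n) * real (i choose n) * real (b choose i) =
        real (b choose n) * ((-1) ^ (i - n) * real ((b - n) choose (i - n)))"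
      by (simp add: mult.assoc)
  qed
  also have "\<dots> = real (b choose n) * (\<Sum>i\<le>b - n. (-1) ^ i * real ((b - n) choose i))"
    unfolding sum_distrib_left using True
    by (intro sum.reindex_bij_witness[of _ "\<lambda>i. i + n" "\<lambda>i. i - n"]) auto
  also have "\<dots> = of_bool (b = n)"
    using True choose_alternating_sum[of "b - n", where ?'a = real] by (cases "b = n") auto
  finally show ?thesis .
qed

section \<open>Clusters, their first points and the long gaps\<close>

lemma same_cluster_sym: "same_cluster X eps i k \<longleftrightarrow> same_cluster X eps k i"
  by (auto simp: same_cluster_def min.commute max.commute)

lemma same_cluster_trans:
  assumes "same_cluster X eps i j" "same_cluster X eps j k"
  shows "same_cluster X eps i k"
  unfolding same_cluster_def
proof (intro conjI allI impI)
  fix l assume "min i k \<le> l \<and> l < max i k"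
  then have "min i j \<le> l \<and> l < max i j \<or> min j k \<le> l \<and> l < max j k"
    by (auto simp: min_def max_def split: if_splits)
  then show "X (Suc l) - X l \<le> eps"
    using assms by (auto simp: same_cluster_def)
qed (use assms in \<open>auto simp: same_cluster_def\<close>)

lemma same_cluster_refl: "1 \<le> i \<Longrightarrow> same_cluster X eps i i"
  by (simp add: same_cluster_def)

text \<open>Counting the clusters through their first points makes the count a measurable function of
  the points even where the interarrival times fail to be positive.\<close>

definition cluster_starts :: "(nat \<Rightarrow> real) \<Rightarrow> real \<Rightarrow> real \<Rightarrow> nat set" where
  "cluster_starts X eps L = {i. 1 \<le> i \<and> (i = 1 \<or> eps < X i - X (i - 1)) \<and>
     (\<exists>l. i \<le> l \<and> (\<forall>j\<in>{i..<l}. X (Suc j) - X j \<le> eps) \<and> 0 \<le> X l \<and> X l \<le> L)}"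

text \<open>The map from an index to its class is a bijection from starts to the clusters counted.
  It works for an arbitrary sequence \<open>X\<close>, since clusters are defined through indices
  alone.\<close>

lemma beta0'_eq_card_cluster_starts: "beta0' X eps L = card (cluster_starts X eps L)"
proof -
  define c where "c i = {k. same_cluster X eps i k}" for i
  have c_eq: "c i = c j" if "same_cluster X eps i j" for i j
    using that same_cluster_trans same_cluster_sym unfolding c_def by blast
  have up: "same_cluster X eps i l \<longleftrightarrow> (\<forall>j\<in>{i..<l}. X (Suc j) - X j \<le> eps)" if "1 \<le> i" "i \<le> l" for i l
    using that by (auto simp: same_cluster_def)
  have "bij_betw c (cluster_starts X eps L) {S \<in> clusters X eps. \<exists>l\<in>S. 0 \<le> X l \<and> X l \<le> L}"
    unfolding bij_betw_def
  proof
    \<comment> \<open>Were \<open>i < j\<close> in one class, the gap from \<open>j - 1\<close> to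
      \<open>j\<close> would be at most \<open>eps\<close>, contrary to \<open>j\<close> being a
      start.\<close>
    have *: False if "i \<in> cluster_starts X eps L" "j \<in> cluster_starts X eps L" "c i = c j" "i < j" for i j
    proof -
      have "same_cluster X eps j j"
        using that by (intro same_cluster_refl) (auto simp: cluster_starts_def)
      then have "same_cluster X eps i j"
        using that by (auto simp: c_def)
      moreover have "i \<le> j - 1" "j - 1 < j" "Suc (j - 1) = j" using that by auto
      ultimately have "X j - X (j - 1) \<le> eps"
        using that unfolding same_cluster_def by (metis max.absorb4 min.absorb3 that(4))
      with that show False by (auto simp: cluster_starts_def)
    qed
    then show "inj_on c (cluster_starts X eps L)"
      by (intro inj_onI) (metis nat_neq_iff)
    show "c ` cluster_starts X eps L = {S \<in> clusters X eps. \<exists>l\<in>S. 0 \<le> X l \<and> X l \<le> L}"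
    proof (intro equalityI subsetI)
      fix S assume "S \<in> c ` cluster_starts X eps L"
      then obtain i l where i: "S = c i" "1 \<le> i" and l: "i \<le> l" "0 \<le> X l" "X l \<le> L"
          and il: "\<forall>j\<in>{i..<l}. X (Suc j) - X j \<le> eps"
        unfolding cluster_starts_def by blast
      have "same_cluster X eps i l" using up[OF i(2) l(1)] il by simp
      then have "l \<in> S" using i by (simp add: c_def)
      then show "S \<in> {S \<in> clusters X eps. \<exists>l\<in>S. 0 \<le> X l \<and> X l \<le> L}"
        using i l unfolding clusters_def c_def by blast
    next
      fix S assume "S \<in> {S \<in> clusters X eps. \<exists>l\<in>S. 0 \<le> X l \<and> X l \<le> L}"
      then obtain i l where i: "1 \<le> i" "S = c i" and l: "same_cluster X eps i l" "0 \<le> X l" "X l \<le> L"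
        by (auto simp: clusters_def c_def)
      \<comment> \<open>The start of a class is its least index: a short gap just before
        \<open>f\<close> would put the predecessor of \<open>f\<close> into the class as
        well.\<close>
      define f where "f = (LEAST k. same_cluster X eps i k)"
      have f: "same_cluster X eps i f"
        unfolding f_def using l(1) by (rule LeastI)
      have f_le: "f \<le> k" if "same_cluster X eps i k" for k
        unfolding f_def using that by (rule Least_le)
      have f1: "1 \<le> f" using f by (simp add: same_cluster_def)
      have fl: "same_cluster X eps f l"
        using f l(1) same_cluster_sym same_cluster_trans by blast
      have "f = 1 \<or> eps < X f - X (f - 1)"
      proof (rule ccontr)
        assume neg: "\<not> ?thesis"
        then obtain g where g: "f = Suc g" "1 \<le> g" "X (Suc g) - X g \<le> eps"
          using f1 by (cases f) auto
        then have "same_cluster X eps g f"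
          by (auto simp: same_cluster_def less_Suc_eq)
        then have "same_cluster X eps i g"
          using f same_cluster_sym same_cluster_trans by blast
        from f_le[OF this] g(1) show False by simp
      qed
      then have "f \<in> cluster_starts X eps L"
        unfolding cluster_starts_def using f1 fl up[OF f1 f_le[OF l(1)]] f_le[OF l(1)] l by auto
      moreover have "S = c f" using i c_eq[OF f] by simp
      ultimately show "S \<in> c ` cluster_starts X eps L" by blast
    qed
  qed
  then show ?thesis
    unfolding beta0'_def by (simp add: bij_betw_same_card)
qed

text \<open>Here \<open>m\<close> is the number of points up to \<open>L\<close>. \<open>T l\<close>
  is the gap between points \<open>l\<close> and \<open>l + 1\<close>, whereas \<open>T 0\<close> is
  the distance from the origin to the first point and is no gap; hence the range
  \<open>{1..<m}\<close>. Each long gap opens a new cluster, in addition to the one opened by point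
  1.\<close>

lemma cluster_starts_pp_point:
  assumes pos: "\<And>i. 0 < T i \<omega>" and m: "pp_point T m \<omega> \<le> L" "L < pp_point T (Suc m) \<omega>"
  shows "cluster_starts (\<lambda>k. pp_point T k \<omega>) eps L =
    (if m = 0 then {} else insert 1 (Suc ` {l\<in>{1..<m}. eps < T l \<omega>}))"
proof -
  let ?X = "\<lambda>k. pp_point T k \<omega>"
  have mono: "?X i \<le> ?X j" if "i \<le> j" for i j
    unfolding pp_point_def using that pos by (intro sum_mono2) (auto intro: less_imp_le)
  have hit: "?X l \<le> L \<longleftrightarrow> l \<le> m" for l
  proof
    assume "?X l \<le> L"
    then show "l \<le> m" using mono[of "Suc m" l] m by (force simp: not_less_eq_eq[symmetric])
  next
    assume "l \<le> m" then show "?X l \<le> L" using mono[of l m] m by simp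
  qed
  have nonneg: "0 \<le> ?X l" for l
    using mono[of 0 l] by (simp add: pp_point_def)
  have step: "?X (Suc l) - ?X l = T l \<omega>" for l
    by (simp add: pp_point_def)
  have "cluster_starts ?X eps L = {i. 1 \<le> i \<and> (i = 1 \<or> eps < ?X i - ?X (i - 1)) \<and> i \<le> m}"
    \<comment> \<open>If \<open>i \<le> m\<close>, then \<open>l = i\<close> is a witness;
      conversely \<open>i \<le> l \<le> m\<close> for any witness \<open>l\<close>.\<close>
    unfolding cluster_starts_def hit by (auto simp: nonneg intro: exI[of _ i for i])
  also have "\<dots> = (if m = 0 then {} else insert 1 (Suc ` {l\<in>{1..<m}. eps < T l \<omega>}))"
  proof -
    have "i \<in> Suc ` {l\<in>{1..<m}. eps < T l \<omega>} \<longleftrightarrow> 1 < i \<and> i \<le> m \<and> eps < ?X i - ?X (i - 1)" for i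
      by (cases i) (auto simp: step)
    then show ?thesis by (auto simp del: One_nat_def)
  qed
  finally show ?thesis .
qed

section \<open>Memorylessness and the joint law of gaps and point count\<close>

text \<open>Applied with \<open>f\<close> the evaluation at the single index of a one-element
  product: it turns independence of restricted families into a product law for \<open>T a\<close>
  and the other interarrival times.\<close>

lemma (in prob_space) indep_var_map_joint:
  assumes "indep_var S Y N Z" and f [measurable]: "f \<in> measurable S S'"
  shows "distr M S' (\<lambda>\<omega>. f (Y \<omega>)) \<Otimes>\<^sub>M distr M N Z = distr M (S' \<Otimes>\<^sub>M N) (\<lambda>\<omega>. (f (Y \<omega>), Z \<omega>))"
proof -
  have Y [measurable]: "Y \<in> measurable M S" and Z [measurable]: "Z \<in> measurable M N"
    and joint: "distr M S Y \<Otimes>\<^sub>M distr M N Z = distr M (S \<Otimes>\<^sub>M N) (\<lambda>\<omega>. (Y \<omega>, Z \<omega>))"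
    using assms(1) indep_var_distribution_eq by auto
  interpret Z: prob_space "distr M N Z" by (rule prob_space_distr) measurable
  have "distr M S' (\<lambda>\<omega>. f (Y \<omega>)) \<Otimes>\<^sub>M distr M N Z =
      distr (distr M S Y) S' f \<Otimes>\<^sub>M distr (distr M N Z) N (\<lambda>z. z)"
    by (simp add: distr_distr comp_def)
  also have "\<dots> = distr (distr M S Y \<Otimes>\<^sub>M distr M N Z) (S' \<Otimes>\<^sub>M N) (\<lambda>(y, z). (f y, z))"
    by (rule pair_measure_distr) (auto simp: distr_distr comp_def intro: Z.sigma_finite_measure_axioms)
  also have "\<dots> = distr M (S' \<Otimes>\<^sub>M N) (\<lambda>\<omega>. (f (Y \<omega>), Z \<omega>))"
    unfolding joint by (subst distr_distr) (auto simp: comp_def)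
  finally show ?thesis .
qed

locale exponential_interarrivals = prob_space M
  for M :: "'a measure" and lam :: real and T :: "nat \<Rightarrow> 'a \<Rightarrow> real" +
  assumes indep: "indep_vars (\<lambda>_. borel) T UNIV"
    and exponential: "\<And>i. distributed M lborel (T i) (exponential_density lam)"
    and lam_pos: "0 < lam"
begin

lemma measurable_T [measurable]: "T i \<in> borel_measurable M"
  using distributed_measurable[OF exponential] by simp

lemma measurable_pp_point [measurable]: "pp_point T k \<in> borel_measurable M"
  unfolding pp_point_def[abs_def] by measurable

lemma AE_T_pos: "AE \<omega> in M. \<forall>i. 0 < T i \<omega>"
  unfolding AE_all_countable
proof
  fix i
  have "prob {\<omega>\<in>space M. 0 < T i \<omega>} = 1"
    using exponential_distributedD_gt[OF exponential order.refl lam_pos] by simp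
  then show "AE \<omega> in M. 0 < T i \<omega>"
    by (subst (asm) prob_eq_1) (auto elim: AE_mp)
qed

text \<open>Memorylessness: given \<open>T i > eps\<close>, the excess \<open>T i - eps\<close> has
  the law of \<open>T i\<close>. No lower bound on \<open>t\<close> is imposed, because
  \<open>t\<close> will be the time left over by the other interarrivals; for \<open>t < eps\<close>
  both sides are zero.\<close>

lemma prob_T_between:
  assumes "0 < eps"
  shows "prob {\<omega>\<in>space M. eps < T i \<omega> \<and> T i \<omega> \<le> t} =
    exp (- lam * eps) * prob {\<omega>\<in>space M. T i \<omega> \<le> t - eps}"
proof (cases "eps \<le> t")
  case True
  have "prob {\<omega>\<in>space M. eps < T i \<omega> \<and> T i \<omega> \<le> t} =
      prob ({\<omega>\<in>space M. T i \<omega> \<le> t} - {\<omega>\<in>space M. T i \<omega> \<le> eps})"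
    by (rule arg_cong[where f = prob]) auto
  also have "\<dots> = prob {\<omega>\<in>space M. T i \<omega> \<le> t} - prob {\<omega>\<in>space M. T i \<omega> \<le> eps}"
    using True by (intro finite_measure_Diff) auto
  also have "\<dots> = exp (- lam * eps) * prob {\<omega>\<in>space M. T i \<omega> \<le> t - eps}"
  proof -
    have le: "prob {\<omega>\<in>space M. T i \<omega> \<le> r} = 1 - exp (- r * lam)" if "0 \<le> r" for r
      using exponential_distributedD_le[OF exponential that lam_pos] .
    have "0 \<le> t" "0 \<le> eps" "0 \<le> t - eps" using True assms by auto
    then show ?thesis
      unfolding le[OF \<open>0 \<le> t\<close>] le[OF \<open>0 \<le> eps\<close>] le[OF \<open>0 \<le> t - eps\<close>]
      by (simp add: algebra_simps flip: exp_add)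
  qed
  finally show ?thesis .
next
  case False
  have "AE \<omega> in M. \<not> T i \<omega> \<le> t - eps"
    using AE_T_pos
  proof eventually_elim
    case (elim \<omega>)
    then have "0 < T i \<omega>" ..
    then show ?case using False by simp
  qed
  then have "prob {\<omega>\<in>space M. T i \<omega> \<le> t - eps} = 0"
    by (intro prob_eq_0[THEN iffD2]) auto
  moreover have "{\<omega>\<in>space M. eps < T i \<omega> \<and> T i \<omega> \<le> t} = {}"
    using False by auto
  ultimately show ?thesis by (simp only: measure_empty mult_zero_right)
qed

text \<open>Fix the value \<open>z\<close> of \<open>Z\<close> by Fubini and apply memorylessness
  with \<open>t = s - h z\<close>. The factor \<open>exp (- lam * eps)\<close> is the same for every
  \<open>z\<close> and leaves the integral.\<close>

lemma prob_shift_one: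
  assumes "0 < eps" and Z [measurable]: "Z \<in> measurable M N"
    and joint: "distr M borel (T i) \<Otimes>\<^sub>M distr M N Z = distr M (borel \<Otimes>\<^sub>M N) (\<lambda>\<omega>. (T i \<omega>, Z \<omega>))"
    and h [measurable]: "h \<in> borel_measurable N" and E [measurable]: "E \<in> sets N"
  shows "prob {\<omega>\<in>space M. eps < T i \<omega> \<and> Z \<omega> \<in> E \<and> T i \<omega> + h (Z \<omega>) \<le> s} =
    exp (- lam * eps) * prob {\<omega>\<in>space M. Z \<omega> \<in> E \<and> T i \<omega> + h (Z \<omega>) \<le> s - eps}"
proof -
  interpret Z: prob_space "distr M N Z" by (rule prob_space_distr) measurable
  interpret Ti: prob_space "distr M borel (T i)" by (rule prob_space_distr) measurable
  interpret P: pair_sigma_finite "distr M borel (T i)" "distr M N Z" ..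
  \<comment> \<open>A general \<open>J\<close> lets one Fubini computation serve both sides:
    \<open>{eps<..}\<close> with bound \<open>s\<close>, and \<open>UNIV\<close> with bound
    \<open>s - eps\<close>.\<close>
  have key: "emeasure M {\<omega>\<in>space M. T i \<omega> \<in> J \<and> Z \<omega> \<in> E \<and> T i \<omega> + h (Z \<omega>) \<le> r} =
      (\<integral>\<^sup>+z. indicator E z * ennreal (prob {\<omega>\<in>space M. T i \<omega> \<in> J \<and> T i \<omega> + h z \<le> r}) \<partial>distr M N Z)"
    if J [measurable]: "J \<in> sets borel" for J r
  proof -
    let ?A = "{p \<in> space (borel \<Otimes>\<^sub>M N). fst p \<in> J \<and> snd p \<in> E \<and> fst p + h (snd p) \<le> r}"
    have A: "?A \<in> sets (borel \<Otimes>\<^sub>M N)" by measurable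
    have "emeasure M {\<omega>\<in>space M. T i \<omega> \<in> J \<and> Z \<omega> \<in> E \<and> T i \<omega> + h (Z \<omega>) \<le> r} =
        emeasure (distr M (borel \<Otimes>\<^sub>M N) (\<lambda>\<omega>. (T i \<omega>, Z \<omega>))) ?A"
      using measurable_space[OF Z]
      by (subst emeasure_distr[OF _ A]) (auto simp: space_pair_measure intro!: arg_cong[where f = "emeasure M"])
    also have "\<dots> = emeasure (distr M borel (T i) \<Otimes>\<^sub>M distr M N Z) ?A"
      unfolding joint ..
    also have "\<dots> = (\<integral>\<^sup>+z. emeasure (distr M borel (T i)) ((\<lambda>x. (x, z)) -` ?A) \<partial>distr M N Z)"
      using A by (intro P.emeasure_pair_measure_alt2) simp
    also have "\<dots> = (\<integral>\<^sup>+z. indicator E z * ennreal (prob {\<omega>\<in>space M. T i \<omega> \<in> J \<and> T i \<omega> + h z \<le> r}) \<partial>distr M N Z)"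
    proof (intro nn_integral_cong)
      fix z assume "z \<in> space (distr M N Z)"
      then have z: "z \<in> space N" by simp
      have "(\<lambda>x. (x, z)) -` ?A = (if z \<in> E then {x. x \<in> J \<and> x + h z \<le> r} else {})"
        using z by (auto simp: space_pair_measure)
      moreover have "emeasure (distr M borel (T i)) {x. x \<in> J \<and> x + h z \<le> r} =
          ennreal (prob {\<omega>\<in>space M. T i \<omega> \<in> J \<and> T i \<omega> + h z \<le> r})"
      proof -
        have "{x. x \<in> J \<and> x + h z \<le> r} \<in> sets borel" by measurable
        then show ?thesis
          by (subst emeasure_distr) (auto simp: emeasure_eq_measure intro!: arg_cong[where f = prob])
      qed
      ultimately show "emeasure (distr M borel (T i)) ((\<lambda>x. (x, z)) -` ?A) =
          indicator E z * ennreal (prob {\<omega>\<in>space M. T i \<omega> \<in> J \<and> T i \<omega> + h z \<le> r})"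
        by auto
    qed
    finally show ?thesis .
  qed
  have "ennreal (prob {\<omega>\<in>space M. eps < T i \<omega> \<and> Z \<omega> \<in> E \<and> T i \<omega> + h (Z \<omega>) \<le> s}) =
      (\<integral>\<^sup>+z. indicator E z * ennreal (prob {\<omega>\<in>space M. eps < T i \<omega> \<and> T i \<omega> + h z \<le> s}) \<partial>distr M N Z)"
    using key[of "{eps<..}" s] by (simp add: emeasure_eq_measure)
  also have "\<dots> = (\<integral>\<^sup>+z. ennreal (exp (- lam * eps)) *
      (indicator E z * ennreal (prob {\<omega>\<in>space M. T i \<omega> + h z \<le> s - eps})) \<partial>distr M N Z)"
  proof (intro nn_integral_cong)
    fix z
    have "prob {\<omega>\<in>space M. eps < T i \<omega> \<and> T i \<omega> + h z \<le> s} =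
        exp (- lam * eps) * prob {\<omega>\<in>space M. T i \<omega> + h z \<le> s - eps}"
      using prob_T_between[OF assms(1), of i "s - h z"] by (simp add: algebra_simps)
    then show "indicator E z * ennreal (prob {\<omega>\<in>space M. eps < T i \<omega> \<and> T i \<omega> + h z \<le> s}) =
        ennreal (exp (- lam * eps)) * (indicator E z * ennreal (prob {\<omega>\<in>space M. T i \<omega> + h z \<le> s - eps}))"
      by (simp add: ennreal_mult mult.left_commute)
  qed
  also have "\<dots> = ennreal (exp (- lam * eps)) *
      (\<integral>\<^sup>+z. indicator E z * ennreal (prob {\<omega>\<in>space M. T i \<omega> + h z \<le> s - eps}) \<partial>distr M N Z)"
  proof (intro nn_integral_cmult)
    \<comment> \<open>Measurability in \<open>z\<close> holds because the probability is the measure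
      of a section of a measurable set.\<close>
    have "(\<lambda>z. emeasure (distr M borel (T i)) ((\<lambda>x. (x, z)) -` {p \<in> space (borel \<Otimes>\<^sub>M N). fst p + h (snd p) \<le> s - eps}))
        \<in> borel_measurable N"
      using P.measurable_emeasure_Pair2[of "{p \<in> space (borel \<Otimes>\<^sub>M N). fst p + h (snd p) \<le> s - eps}"] by simp
    moreover have "emeasure (distr M borel (T i)) ((\<lambda>x. (x, z)) -` {p \<in> space (borel \<Otimes>\<^sub>M N). fst p + h (snd p) \<le> s - eps})
        = ennreal (prob {\<omega>\<in>space M. T i \<omega> + h z \<le> s - eps})" if "z \<in> space N" for z
      using that by (subst emeasure_distr)
        (auto simp: emeasure_eq_measure space_pair_measure vimage_def intro!: arg_cong[where f = prob])
    ultimately have "(\<lambda>z. ennreal (prob {\<omega>\<in>space M. T i \<omega> + h z \<le> s - eps})) \<in> borel_measurable N"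
      by (subst (asm) measurable_cong) auto
    then show "(\<lambda>z. indicator E z * ennreal (prob {\<omega>\<in>space M. T i \<omega> + h z \<le> s - eps}))
        \<in> borel_measurable (distr M N Z)" by simp
  qed
  also have "\<dots> = ennreal (exp (- lam * eps)) *
      ennreal (prob {\<omega>\<in>space M. Z \<omega> \<in> E \<and> T i \<omega> + h (Z \<omega>) \<le> s - eps})"
    using key[of UNIV "s - eps"] by (simp add: emeasure_eq_measure)
  finally show ?thesis
    by (simp add: ennreal_mult[symmetric])
qed

text \<open>Induction on \<open>A\<close>, one application of \<open>prob_shift_one\<close> per
  element. As \<open>a\<close> is not in \<open>A\<close>, the conditions on \<open>A\<close> and
  the rest of the sum depend only on the times other than \<open>T a\<close>. The bound
  \<open>s\<close> drops by \<open>eps\<close> each time, so it stays arbitrary.\<close>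

lemma prob_gaps_sum_le:
  assumes "0 < eps" "finite I" "A \<subseteq> I"
  shows "prob {\<omega>\<in>space M. (\<forall>a\<in>A. eps < T a \<omega>) \<and> (\<Sum>i\<in>I. T i \<omega>) \<le> s} =
    exp (- real (card A) * lam * eps) * prob {\<omega>\<in>space M. (\<Sum>i\<in>I. T i \<omega>) \<le> s - real (card A) * eps}"
proof -
  have "finite A" using assms finite_subset by blast
  then show ?thesis using assms(3)
  proof (induction A arbitrary: s rule: finite_induct)
    case empty
    then show ?case by simp
  next
    case (insert a A)
    let ?J = "I - {a}"
    let ?N = "PiM ?J (\<lambda>_. borel) :: (nat \<Rightarrow> real) measure"
    let ?Z = "\<lambda>\<omega>. restrict (\<lambda>i. T i \<omega>) ?J"
    let ?E = "{z \<in> space ?N. \<forall>b\<in>A. eps < z b}"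
    have A: "finite A" "A \<subseteq> ?J" using insert by auto
    have sum: "(\<Sum>i\<in>I. T i \<omega>) = T a \<omega> + (\<Sum>i\<in>?J. ?Z \<omega> i)" for \<omega>
      using insert assms(2) by (subst sum.remove[of I a]) auto
    have E: "?Z \<omega> \<in> ?E \<longleftrightarrow> (\<forall>b\<in>A. eps < T b \<omega>)" for \<omega>
      using A by (auto simp: space_PiM)
    have "indep_var (PiM {a} (\<lambda>_. borel)) (\<lambda>\<omega>. restrict (\<lambda>i. T i \<omega>) {a}) ?N ?Z"
      by (rule indep_var_restrict[OF indep]) auto
    then have joint: "distr M borel (T a) \<Otimes>\<^sub>M distr M ?N ?Z = distr M (borel \<Otimes>\<^sub>M ?N) (\<lambda>\<omega>. (T a \<omega>, ?Z \<omega>))"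
      using indep_var_map_joint[of "PiM {a} (\<lambda>_. borel)" "\<lambda>\<omega>. restrict (\<lambda>i. T i \<omega>) {a}" ?N ?Z "\<lambda>f. f a" borel] by simp
    have meas: "(\<lambda>z. z b) \<in> borel_measurable ?N" if "b \<in> A" for b
      using A that by (intro measurable_component_singleton) auto
    have "?E \<in> sets ?N"
      using A(1) meas by (intro sets.sets_Collect_finite_All) (auto intro!: borel_measurable_less)
    then have "prob {\<omega>\<in>space M. eps < T a \<omega> \<and> ?Z \<omega> \<in> ?E \<and> T a \<omega> + (\<Sum>i\<in>?J. ?Z \<omega> i) \<le> s} =
        exp (- lam * eps) * prob {\<omega>\<in>space M. ?Z \<omega> \<in> ?E \<and> T a \<omega> + (\<Sum>i\<in>?J. ?Z \<omega> i) \<le> s - eps}"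
      by (intro prob_shift_one[OF assms(1) _ joint, where h = "\<lambda>z. \<Sum>i\<in>?J. z i"]) auto
    then have "prob {\<omega>\<in>space M. (\<forall>b\<in>insert a A. eps < T b \<omega>) \<and> (\<Sum>i\<in>I. T i \<omega>) \<le> s} =
        exp (- lam * eps) * prob {\<omega>\<in>space M. (\<forall>b\<in>A. eps < T b \<omega>) \<and> (\<Sum>i\<in>I. T i \<omega>) \<le> s - eps}"
      unfolding E sum[symmetric] by (simp add: conj_assoc)
    also have "\<dots> = exp (- lam * eps) * (exp (- real (card A) * lam * eps) *
        prob {\<omega>\<in>space M. (\<Sum>i\<in>I. T i \<omega>) \<le> s - eps - real (card A) * eps})"
      using insert by (subst insert.IH) auto
    finally show ?case
      using insert.hyps by (simp add: algebra_simps flip: exp_add)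
  qed
qed

lemma prob_pp_point_le:
  assumes "0 \<le> s"
  shows "prob {\<omega>\<in>space M. pp_point T (Suc m) \<omega> \<le> s} = 1 - (\<Sum>n\<le>m. (lam * s) ^ n / fact n) * exp (- lam * s)"
proof -
  have "distributed M lborel (\<lambda>\<omega>. \<Sum>i<Suc m. T i \<omega>) (erlang_density (card {..<Suc m} - 1) lam)"
    by (rule exponential_distributed_sum) (use lam_pos exponential indep_vars_subset[OF indep] in auto)
  from erlang_distributed_le[OF this lam_pos assms] assms show ?thesis
    by (simp add: pp_point_def[abs_def] erlang_CDF_def sum_distrib_right del: sum.lessThan_Suc)
qed

lemma prob_pp_point_le_neg:
  assumes "s < 0"
  shows "prob {\<omega>\<in>space M. pp_point T m \<omega> \<le> s} = 0"
proof -
  have "AE \<omega> in M. \<not> pp_point T m \<omega> \<le> s"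
    using AE_T_pos
  proof eventually_elim
    case (elim \<omega>)
    then have "0 \<le> pp_point T m \<omega>"
      unfolding pp_point_def by (intro sum_nonneg) (auto intro: less_imp_le)
    then show ?case using assms by simp
  qed
  then show ?thesis by (intro prob_eq_0[THEN iffD2]) auto
qed

text \<open>Having exactly \<open>Suc m\<close> points is the difference of two events bounding a
  single point by \<open>L\<close>. After shifting both windows by \<open>card A * eps\<close>, the
  Erlang distribution functions differ by one Poisson term, and the exponentials combine to
  \<open>exp (- lam * L)\<close>.\<close>

lemma prob_gaps_count:
  assumes "0 < eps" "A \<subseteq> {..<Suc m}"
  shows "prob {\<omega>\<in>space M. (\<forall>a\<in>A. eps < T a \<omega>) \<and> pp_point T (Suc m) \<omega> \<le> L \<and> L < pp_point T (Suc (Suc m)) \<omega>} =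
    (if real (card A) * eps < L then exp (- lam * L) * ((lam * (L - real (card A) * eps)) ^ Suc m / fact (Suc m)) else 0)"
proof -
  let ?S = "\<lambda>m. {\<omega>\<in>space M. (\<forall>a\<in>A. eps < T a \<omega>) \<and> pp_point T m \<omega> \<le> L}"
  let ?s = "L - real (card A) * eps"
  have finA: "finite A" using assms finite_subset by blast
  have m: "?S m \<in> sets M" for m
    using finA by measurable
  have "prob {\<omega>\<in>space M. (\<forall>a\<in>A. eps < T a \<omega>) \<and> pp_point T (Suc m) \<omega> \<le> L \<and> L < pp_point T (Suc (Suc m)) \<omega>} =
      prob (?S (Suc m) - (?S (Suc (Suc m)) \<inter> ?S (Suc m)))"
    by (rule arg_cong[where f = prob]) auto
  also have "\<dots> = prob (?S (Suc m)) - prob (?S (Suc (Suc m)) \<inter> ?S (Suc m))"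
    using m by (intro finite_measure_Diff) auto
  also have "prob (?S (Suc (Suc m)) \<inter> ?S (Suc m)) = prob (?S (Suc (Suc m)))"
  \<comment> \<open>The inclusion of the events holds only almost surely, as the interarrival times
    are positive only off a null set.\<close>
  proof (rule finite_measure_eq_AE)
    show "AE \<omega> in M. (\<omega> \<in> ?S (Suc (Suc m)) \<inter> ?S (Suc m)) = (\<omega> \<in> ?S (Suc (Suc m)))"
      using AE_T_pos
    proof eventually_elim
      case (elim \<omega>)
      then have "pp_point T (Suc m) \<omega> \<le> pp_point T (Suc (Suc m)) \<omega>"
        by (simp add: pp_point_def less_imp_le)
      then show ?case by auto
    qed
  qed (use m in auto)
  also have "prob (?S (Suc m)) - prob (?S (Suc (Suc m))) = exp (- real (card A) * lam * eps) *
      (prob {\<omega>\<in>space M. pp_point T (Suc m) \<omega> \<le> ?s} - prob {\<omega>\<in>space M. pp_point T (Suc (Suc m)) \<omega> \<le> ?s})"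
    unfolding pp_point_def using assms
    by (subst (1 2) prob_gaps_sum_le) (auto simp: right_diff_distrib)
  also have "\<dots> = (if real (card A) * eps < L then exp (- lam * L) * ((lam * ?s) ^ Suc m / fact (Suc m)) else 0)"
  proof (cases "0 \<le> ?s")
    case True
    have "exp (- real (card A) * lam * eps) * exp (- lam * ?s) = exp (- lam * L)"
      by (simp add: algebra_simps flip: exp_add)
    moreover have "prob {\<omega>\<in>space M. pp_point T (Suc m) \<omega> \<le> ?s} - prob {\<omega>\<in>space M. pp_point T (Suc (Suc m)) \<omega> \<le> ?s} =
       exp (- lam * ?s) * ((lam * ?s) ^ Suc m / fact (Suc m))"
      using True by (simp only: prob_pp_point_le sum.atMost_Suc) (simp add: algebra_simps)
    ultimately have "exp (- real (card A) * lam * eps) *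
      (prob {\<omega>\<in>space M. pp_point T (Suc m) \<omega> \<le> ?s} - prob {\<omega>\<in>space M. pp_point T (Suc (Suc m)) \<omega> \<le> ?s}) =
      exp (- lam * L) * ((lam * ?s) ^ Suc m / fact (Suc m))"
      by (metis mult.assoc)
    \<comment> \<open>On the boundary the power \<open>Suc m\<close> of zero vanishes, in agreement
      with the strict inequality in \<open>G\<close>.\<close>
    moreover have "?s = 0" if "\<not> real (card A) * eps < L" using that True by simp
    ultimately show ?thesis by (auto simp del: power_Suc fact_Suc)
  next
    case False
    then show ?thesis by (simp add: prob_pp_point_le_neg)
  qed
  finally show ?thesis .
qed

end

text \<open>The substitution \<open>u = lam * (L - k * eps)\<close> explains the shape of
  \<open>G\<close>: the partial exponential sum is taken at \<open>- u\<close>, and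
  \<open>exp (- lam * L) * exp u\<close> is its factor \<open>exp (- k * lam * eps)\<close>.\<close>

lemma G_sums:
  "(\<lambda>m. real (m choose k) * (if real k * eps < L
      then exp (- lam * L) * ((lam * (L - real k * eps)) ^ Suc m / fact (Suc m)) else 0))
    sums G lam eps L (int k)"
proof (cases "real k * eps < L")
  case True
  define u where "u = lam * (L - real k * eps)"
  define S where "S = (\<Sum>j\<le>k. (- u) ^ j / fact j)"
  have "(\<lambda>m. exp (- lam * L) * (real (m choose k) * (u ^ Suc m / fact (Suc m)))) sums
      (exp (- lam * L) * ((-1) ^ k * (S * exp u - 1)))"
    unfolding S_def by (intro sums_mult choose_exp_Suc_sums)
  also have "exp (- lam * L) * ((-1) ^ k * (S * exp u - 1)) =
      (-1) ^ k * ((exp (- lam * L) * exp u) * S - exp (- lam * L))"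
    by (simp add: algebra_simps)
  also have "exp (- lam * L) * exp u = exp (- real k * lam * eps)"
    unfolding u_def by (simp add: algebra_simps flip: exp_add)
  also have "(-1) ^ k * (exp (- real k * lam * eps) * S - exp (- lam * L)) = G lam eps L (int k)"
  proof -
    have "- u = lam * (real k * eps - L)" by (simp add: u_def algebra_simps)
    then show ?thesis using True by (simp add: G_def S_def)
  qed
  finally show ?thesis
    using True by (simp add: u_def mult.left_commute del: power_Suc fact_Suc)
next
  case False
  then show ?thesis by (simp add: G_def)
qed

section \<open>Binomial moments of the number of long gaps\<close>

context exponential_interarrivals
begin

text \<open>Points do not accumulate below \<open>L\<close>: the probability that all of them are at
  most \<open>L\<close> is bounded by that for point \<open>Suc m\<close>, which tends to zero as
  the exponential series converges.\<close>

lemma AE_point_count: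
  assumes "0 < L"
  shows "AE \<omega> in M. \<exists>m. pp_point T m \<omega> \<le> L \<and> L < pp_point T (Suc m) \<omega>"
proof -
  let ?Z = "{\<omega>\<in>space M. \<forall>m. pp_point T m \<omega> \<le> L}"
  have Z: "?Z \<in> events" by measurable
  have "(\<lambda>m. 1 - (\<Sum>n\<le>m. (lam * L) ^ n / fact n) * exp (- lam * L)) \<longlonglongrightarrow> 1 - exp (lam * L) * exp (- lam * L)"
    using exp_converges[of "lam * L"]
    by (intro tendsto_intros) (simp add: sums_def_le divide_inverse mult.commute)
  moreover have "prob ?Z \<le> 1 - (\<Sum>n\<le>m. (lam * L) ^ n / fact n) * exp (- lam * L)" for m
    unfolding prob_pp_point_le[OF less_imp_le[OF assms], symmetric]
    by (rule finite_measure_mono) auto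
  ultimately have "prob ?Z \<le> 1 - exp (lam * L) * exp (- lam * L)"
    by (intro LIMSEQ_le_const) auto
  then have "prob ?Z = 0"
    using measure_nonneg[of M ?Z] by (simp flip: exp_add)
  then have "AE \<omega> in M. \<not> (\<forall>m. pp_point T m \<omega> \<le> L)"
    using Z by (subst (asm) prob_eq_0) auto
  then show ?thesis
  proof eventually_elim
    case (elim \<omega>)
    then obtain j where "L < pp_point T j \<omega>" by (auto simp: not_le)
    \<comment> \<open>The empty sum puts point 0 at the origin, so a last index with point at most
      \<open>L\<close> exists; \<open>m = 0\<close> means that there is no point up to
      \<open>L\<close>.\<close>
    moreover have "\<not> L < pp_point T 0 \<omega>" using assms by (simp add: pp_point_def)
    ultimately obtain m where "\<not> L < pp_point T m \<omega>" "L < pp_point T (Suc m) \<omega>"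
      using ex_least_nat_less[of "\<lambda>m. L < pp_point T m \<omega>" j] by (meson order.refl)
    then show ?case by (auto simp: not_less)
  qed
qed

text \<open>Almost surely this is \<open>D choose k\<close> on the event of exactly
  \<open>m + 1\<close> points, and zero elsewhere, where \<open>D\<close> is the number of long
  gaps. Listing the \<open>k\<close>-element sets of gaps makes it a finite sum of indicators with
  known probabilities.\<close>

definition gap_sets :: "real \<Rightarrow> real \<Rightarrow> nat \<Rightarrow> nat \<Rightarrow> 'a \<Rightarrow> real" where
  "gap_sets eps L k m \<omega> = (\<Sum>A | A \<subseteq> {1..m} \<and> card A = k.
     indicator {\<omega>\<in>space M. (\<forall>a\<in>A. eps < T a \<omega>) \<and> pp_point T (Suc m) \<omega> \<le> L \<and> L < pp_point T (Suc (Suc m)) \<omega>} \<omega>)"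

definition gap_moment :: "real \<Rightarrow> real \<Rightarrow> nat \<Rightarrow> 'a \<Rightarrow> real" where
  "gap_moment eps L k \<omega> = (\<Sum>m. gap_sets eps L k m \<omega>)"

text \<open>The points increase, so only the index \<open>j\<close> with \<open>Suc j = m\<close>
  contributes. There, the sets counted are the \<open>k\<close>-element subsets of the set of long
  gaps.\<close>

lemma gap_sets_eq:
  assumes pos: "\<And>i. 0 < T i \<omega>" and "\<omega> \<in> space M"
    and m: "pp_point T m \<omega> \<le> L" "L < pp_point T (Suc m) \<omega>"
  shows "gap_sets eps L k j \<omega> = (if Suc j = m then real (card {l\<in>{1..<m}. eps < T l \<omega>} choose k) else 0)"
proof -
  have mono: "pp_point T i \<omega> \<le> pp_point T j \<omega>" if "i \<le> j" for i j
    unfolding pp_point_def using that pos by (intro sum_mono2) (auto intro: less_imp_le)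
  have count: "pp_point T (Suc j) \<omega> \<le> L \<and> L < pp_point T (Suc (Suc j)) \<omega> \<longleftrightarrow> Suc j = m"
  proof
    assume j: "pp_point T (Suc j) \<omega> \<le> L \<and> L < pp_point T (Suc (Suc j)) \<omega>"
    have "\<not> Suc m \<le> Suc j" "\<not> Suc (Suc j) \<le> m"
      using mono[of "Suc m" "Suc j"] mono[of "Suc (Suc j)" m] j m by auto
    then show "Suc j = m" by simp
  qed (use m in auto)
  have "gap_sets eps L k j \<omega> = (\<Sum>A | A \<subseteq> {1..j} \<and> card A = k. of_bool (Suc j = m \<and> (\<forall>a\<in>A. eps < T a \<omega>)))"
    unfolding gap_sets_def indicator_def using count assms(2) by (intro sum.cong) auto
  also have "\<dots> = (if Suc j = m then real (card {l\<in>{1..<m}. eps < T l \<omega>} choose k) else 0)"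
  proof (cases "Suc j = m")
    case True
    have fin: "finite {A. A \<subseteq> {1..j} \<and> card A = k}" by simp
    have "(\<Sum>A | A \<subseteq> {1..j} \<and> card A = k. of_bool (\<forall>a\<in>A. eps < T a \<omega>)) =
        real (card ({A. A \<subseteq> {1..j} \<and> card A = k} \<inter> {A. \<forall>a\<in>A. eps < T a \<omega>}))"
      using fin by (simp add: sum_of_bool_eq)
    also have "{A. A \<subseteq> {1..j} \<and> card A = k} \<inter> {A. \<forall>a\<in>A. eps < T a \<omega>} =
        {A. A \<subseteq> {l\<in>{1..<m}. eps < T l \<omega>} \<and> card A = k}"
      using True by (auto simp: less_Suc_eq_le subset_iff)
    also have "card \<dots> = card {l\<in>{1..<m}. eps < T l \<omega>} choose k"
      by (rule n_subsets) simp
    finally show ?thesis using True by simp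
  qed simp
  finally show ?thesis .
qed

lemma gap_moment_eq:
  assumes "\<And>i. 0 < T i \<omega>" "\<omega> \<in> space M" "pp_point T m \<omega> \<le> L" "L < pp_point T (Suc m) \<omega>"
  shows "gap_moment eps L k \<omega> = (if m = 0 then 0 else real (card {l\<in>{1..<m}. eps < T l \<omega>} choose k))"
proof -
  have "gap_moment eps L k \<omega> = (\<Sum>j. if Suc j = m then real (card {l\<in>{1..<m}. eps < T l \<omega>} choose k) else 0)"
    unfolding gap_moment_def gap_sets_eq[OF assms] ..
  also have "\<dots> = (if m = 0 then 0 else real (card {l\<in>{1..<m}. eps < T l \<omega>} choose k))"
    by (cases m) (auto simp: sums_single[THEN sums_unique, symmetric])
  finally show ?thesis .
qed

lemma measurable_gap_sets [measurable]: "gap_sets eps L k m \<in> borel_measurable M"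
proof -
  have "finite A" if "A \<subseteq> {1..m}" for A :: "nat set" using that finite_subset by blast
  then show ?thesis
    unfolding gap_sets_def[abs_def]
    by (intro borel_measurable_sum borel_measurable_indicator) measurable
qed

lemma integral_gap_sets:
  assumes "0 < eps"
  shows "integrable M (gap_sets eps L k m)"
    and "integral\<^sup>L M (gap_sets eps L k m) = real (m choose k) * (if real k * eps < L
      then exp (- lam * L) * ((lam * (L - real k * eps)) ^ Suc m / fact (Suc m)) else 0)"
proof -
  let ?B = "\<lambda>A. {\<omega>\<in>space M. (\<forall>a\<in>A. eps < T a \<omega>) \<and> pp_point T (Suc m) \<omega> \<le> L \<and> L < pp_point T (Suc (Suc m)) \<omega>}"
  have B: "?B A \<in> events" if "A \<subseteq> {1..m}" for A
  proof -
    have "finite A" using that finite_subset by blast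
    then show ?thesis by measurable
  qed
  have int: "integrable M (indicator (?B A) :: 'a \<Rightarrow> real)" if "A \<in> {A. A \<subseteq> {1..m} \<and> card A = k}" for A
    using B that by (auto simp: emeasure_eq_measure)
  show "integrable M (gap_sets eps L k m)"
    unfolding gap_sets_def[abs_def] using int by (intro Bochner_Integration.integrable_sum) auto
  have "integral\<^sup>L M (gap_sets eps L k m) = (\<Sum>A | A \<subseteq> {1..m} \<and> card A = k. prob (?B A))"
    unfolding gap_sets_def[abs_def] using int B
    by (subst Bochner_Integration.integral_sum) (auto intro!: sum.cong)
  also have "\<dots> = (\<Sum>A | A \<subseteq> {1..m} \<and> card A = k. if real k * eps < L
      then exp (- lam * L) * ((lam * (L - real k * eps)) ^ Suc m / fact (Suc m)) else 0)"
  proof (intro sum.cong refl)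
    fix A assume "A \<in> {A. A \<subseteq> {1..m} \<and> card A = k}"
    then have "A \<subseteq> {..<Suc m}" "card A = k" by auto
    then show "prob (?B A) = (if real k * eps < L
      then exp (- lam * L) * ((lam * (L - real k * eps)) ^ Suc m / fact (Suc m)) else 0)"
      using prob_gaps_count[OF assms \<open>A \<subseteq> {..<Suc m}\<close>, of L] by simp
  qed
  also have "\<dots> = real (m choose k) * (if real k * eps < L
      then exp (- lam * L) * ((lam * (L - real k * eps)) ^ Suc m / fact (Suc m)) else 0)"
    using n_subsets[of "{1..m}" k] by simp
  finally show "integral\<^sup>L M (gap_sets eps L k m) = \<dots>" .
qed

text \<open>Sum and expectation may be exchanged: the terms are nonnegative, almost surely only
  finitely many are nonzero, and their expectations are summable by \<open>G_sums\<close>.\<close>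

lemma expectation_gap_moment:
  assumes "0 < eps" "0 < L"
  shows "integrable M (gap_moment eps L k)"
    and "expectation (gap_moment eps L k) = G lam eps L (int k)"
proof -
  have norm: "norm (gap_sets eps L k m \<omega>) = gap_sets eps L k m \<omega>" for m \<omega>
    by (simp add: gap_sets_def sum_nonneg)
  have sums: "(\<lambda>m. expectation (gap_sets eps L k m)) sums G lam eps L (int k)"
    unfolding integral_gap_sets(2)[OF assms(1)] by (rule G_sums)
  have summable: "AE \<omega> in M. summable (\<lambda>m. norm (gap_sets eps L k m \<omega>))"
    using AE_T_pos AE_point_count[OF assms(2)] AE_space
  proof eventually_elim
    case (elim \<omega>)
    then obtain m where "pp_point T m \<omega> \<le> L" "L < pp_point T (Suc m) \<omega>" by blast
    then have "gap_sets eps L k j \<omega> = 0" if "j \<notin> {..<m}" for j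
      using that gap_sets_eq[of \<omega> m L eps k j] elim by auto
    then show ?case
      unfolding norm by (intro summable_finite[of "{..<m}"]) auto
  qed
  have summable': "summable (\<lambda>m. expectation (\<lambda>\<omega>. norm (gap_sets eps L k m \<omega>)))"
    unfolding norm using sums by (simp add: sums_iff)
  show "integrable M (gap_moment eps L k)"
    unfolding gap_moment_def[abs_def]
    by (rule integrable_suminf[OF integral_gap_sets(1)[OF assms(1)] summable summable'])
  have "(\<lambda>m. expectation (gap_sets eps L k m)) sums expectation (gap_moment eps L k)"
    unfolding gap_moment_def[abs_def]
    by (rule sums_integral[OF integral_gap_sets(1)[OF assms(1)] summable summable'])
  with sums show "expectation (gap_moment eps L k) = G lam eps L (int k)"
    by (rule sums_unique2[symmetric])
qed

section \<open>The law of the cluster count\<close>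

definition cluster_count :: "real \<Rightarrow> real \<Rightarrow> 'a \<Rightarrow> nat" where
  "cluster_count eps L \<omega> = beta0' (\<lambda>k. pp_point T k \<omega>) eps L"

lemma measurable_cluster_count [measurable]: "cluster_count eps L \<in> measurable M (count_space UNIV)"
  unfolding cluster_count_def[abs_def] beta0'_eq_card_cluster_starts
  by (rule measurable_card) (simp add: cluster_starts_def)

text \<open>Almost surely this is the cluster count choose \<open>i\<close>: by Pascal's rule
  \<open>(1 + D) choose Suc k\<close> splits into \<open>D choose k\<close> and
  \<open>D choose Suc k\<close>. Without points up to \<open>L\<close> both gap moments are zero, as
  is \<open>0 choose Suc k\<close>.\<close>

definition cluster_moment :: "real \<Rightarrow> real \<Rightarrow> nat \<Rightarrow> 'a \<Rightarrow> real" where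
  "cluster_moment eps L i \<omega> =
     (case i of 0 \<Rightarrow> 1 | Suc k \<Rightarrow> gap_moment eps L k \<omega> + gap_moment eps L (Suc k) \<omega>)"

lemma expectation_cluster_moment:
  assumes "0 < eps" "0 < L"
  shows "integrable M (cluster_moment eps L i)"
    and "expectation (cluster_moment eps L i) = G lam eps L (int i - 1) + G lam eps L (int i)"
proof -
  have "integrable M (cluster_moment eps L i) \<and>
    expectation (cluster_moment eps L i) = G lam eps L (int i - 1) + G lam eps L (int i)"
  proof (cases i)
    \<comment> \<open>The value \<open>G (-1) = exp (- lam * L)\<close> complements
      \<open>G 0 = 1 - exp (- lam * L)\<close> to the zeroth moment 1.\<close>
    case 0
    then show ?thesis
      using assms by (simp add: cluster_moment_def[abs_def] G_def prob_space)
  next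
    case (Suc k)
    have "G lam eps L (1 + int k) = expectation (gap_moment eps L (Suc k))"
      using expectation_gap_moment(2)[OF assms, of "Suc k"] by simp
    then show ?thesis
      using Suc expectation_gap_moment[OF assms] by (simp add: cluster_moment_def[abs_def])
  qed
  then show "integrable M (cluster_moment eps L i)"
    and "expectation (cluster_moment eps L i) = G lam eps L (int i - 1) + G lam eps L (int i)"
    by auto
qed

text \<open>Each of the \<open>D\<close> long gaps uses more than \<open>eps\<close> of the window,
  so \<open>D * eps \<le> L\<close>, and there are at most \<open>D + 1\<close> clusters.\<close>

lemma AE_cluster_count:
  assumes "0 < eps" "0 < L"
  shows "AE \<omega> in M. cluster_count eps L \<omega> \<le> nat \<lfloor>L / eps\<rfloor> + 1 \<and>
    (\<forall>i. cluster_moment eps L i \<omega> = real (cluster_count eps L \<omega> choose i))"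
  using AE_T_pos AE_point_count[OF assms(2)] AE_space
proof eventually_elim
  case (elim \<omega>)
  then have pos: "0 < T i \<omega>" for i by blast
  obtain m where m: "pp_point T m \<omega> \<le> L" "L < pp_point T (Suc m) \<omega>" using elim by blast
  define D where "D = {l\<in>{1..<m}. eps < T l \<omega>}"
  have "finite D" by (simp add: D_def)
  then have "card (insert 1 (Suc ` D)) = Suc (card D)"
    by (subst card_insert_disjoint) (auto simp: card_image D_def)
  then have count: "cluster_count eps L \<omega> = (if m = 0 then 0 else Suc (card D))"
    unfolding cluster_count_def beta0'_eq_card_cluster_starts cluster_starts_pp_point[OF pos m] D_def[symmetric]
    by simp
  have "real (card D) * eps \<le> (\<Sum>l\<in>D. T l \<omega>)"
    using sum_bounded_below[of D eps "\<lambda>l. T l \<omega>"] by (simp add: D_def less_imp_le)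
  also have "\<dots> \<le> pp_point T m \<omega>"
    unfolding pp_point_def using pos by (intro sum_mono2) (auto simp: D_def intro: less_imp_le)
  also have "\<dots> \<le> L" by (rule m)
  finally have "real (card D) \<le> L / eps" using assms by (simp add: field_simps)
  then have "card D \<le> nat \<lfloor>L / eps\<rfloor>" by (simp add: le_nat_floor)
  moreover have "cluster_moment eps L i \<omega> = real (cluster_count eps L \<omega> choose i)" for i
    unfolding cluster_moment_def count using gap_moment_eq[OF pos elim(3) m, of eps]
    by (auto simp: D_def split: nat.split)
  ultimately show ?case using count by auto
qed

text \<open>Inversion is applied pointwise: almost surely the indicator of the event equals the
  alternating sum of the cluster moments, because the count is at most \<open>?K\<close>. The sum is
  finite, so linearity of expectation finishes.\<close>

lemma prob_cluster_count:
  assumes "0 < eps" "0 < L"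
  shows "prob {\<omega>\<in>space M. cluster_count eps L \<omega> = n} =
    (\<Sum>i = n..nat \<lfloor>L / eps\<rfloor> + 1.
       (-1) ^ (i + n) * real (i choose n) * (G lam eps L (int i - 1) + G lam eps L (int i)))"
proof -
  let ?c = "\<lambda>i. (-1) ^ (i + n) * real (i choose n)"
  let ?K = "nat \<lfloor>L / eps\<rfloor> + 1"
  have "prob {\<omega>\<in>space M. cluster_count eps L \<omega> = n} =
      expectation (indicator {\<omega>\<in>space M. cluster_count eps L \<omega> = n})"
    by simp
  also have "\<dots> = expectation (\<lambda>\<omega>. \<Sum>i = n..?K. ?c i * cluster_moment eps L i \<omega>)"
  proof (rule integral_cong_AE)
    have [measurable]: "cluster_moment eps L i \<in> borel_measurable M" for i
      using expectation_cluster_moment(1)[OF assms] by blast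
    show "(\<lambda>\<omega>. \<Sum>i = n..?K. ?c i * cluster_moment eps L i \<omega>) \<in> borel_measurable M"
      by measurable
    show "AE \<omega> in M. indicator {\<omega>\<in>space M. cluster_count eps L \<omega> = n} \<omega> =
        (\<Sum>i = n..?K. ?c i * cluster_moment eps L i \<omega>)"
      using AE_cluster_count[OF assms] AE_space
    proof eventually_elim
      case (elim \<omega>)
      then show ?case
        using binomial_moment_inversion[of "cluster_count eps L \<omega>" ?K n] by (simp add: indicator_def)
    qed
  qed measurable
  also have "\<dots> = (\<Sum>i = n..?K. ?c i * expectation (cluster_moment eps L i))"
    using expectation_cluster_moment(1)[OF assms]
    by (subst Bochner_Integration.integral_sum) auto
  finally show ?thesis
    unfolding expectation_cluster_moment(2)[OF assms] .
qed

end

theorem theorem6: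
  fixes M :: "'a measure" and T :: "nat \<Rightarrow> 'a \<Rightarrow> real"
    and lam eps L :: real and n :: nat
  assumes "poisson_process_interarrivals M lam T"
    and "lam > 0" and "eps > 0" and "L > 0"
  shows "measure M {\<omega> \<in> space M. beta0' (\<lambda>k. pp_point T k \<omega>) eps L = n} =
    (\<Sum>i = n..nat \<lfloor>L / eps\<rfloor> + 1.
       (-1) ^ (i + n) * real (i choose n) * (G lam eps L (int i - 1) + G lam eps L (int i)))"
proof -
  interpret prob_space M
    using assms by (simp add: poisson_process_interarrivals_def)
  interpret exponential_interarrivals M lam T
    using assms by unfold_locales (auto simp: poisson_process_interarrivals_def)
  show ?thesis
    using prob_cluster_count[OF assms(3,4)] by (simp add: cluster_count_def)
qed

end
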